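(* Consider a network with maps $\mathcal D$, $\mathcal Y$, $\mathcal G(z,d)=(\mathcal Y(d),\mathcal D(z))$ as described in the context, and let $\mathrm{Low}(\mathcal G)=\{(z,d)\ge0:(z,d)\le\mathcal G(z,d)\}$. Let $(I_k)_{k\ge1}$ be a sequence of subsets of the node set $\mathcal I$ such that every node $i\in\mathcal I$ belongs to $I_k$ for infinitely many $k$, and let $(z^k,d^k)_{k\ge0}$ be any sequence produced by AsyncTFA with these sets. Then the sequence $(z^k,d^k)$ is (wide-sense) increasing. If $\mathrm{Low}(\mathcal G)$ is bounded, then the sequence $(z^k,d^k)$ converges to the largest element $(\bar z,\bar d)$ of $\mathrm{Low}(\mathcal G)$. Otherwise it does not converge.
   Context: **Network.** There is a finite set $\mathcal I$ of nodes (output ports) and a finite set of flows. Each flow $f$ has a rate $r_f>0$, a source burstiness $b_f>0$, and a path, i.e. a finite sequence of distinct nodes. The graph induced by flows has vertex set $\mathcal I$ and an edge $(i,j)$ whenever some flow visits $j$ immediately after $i$; such a flow is said to be carried by $(i,j)$. Let $\mathcal L$ be the set of these edges (transit edges); the graph may contain cycles. $\mathrm{In}(i)$ and $\mathrm{Out}(i)$ are the sets of edges of $\mathcal L$ entering, respectively leaving, node $i$. For an edge $\ell=(i,j)$ carried by flow $f$, $\mathrm{Pred}_f(\ell)$ is the set of nodes on the path of $f$ up to and including $i$. **Variables.** $z=(z_{\ell,f})$ is a nonnegative real vector indexed by pairs ($\ell\in\mathcal L$, $f$ carried by $\ell$); $d=(d_i^f)$ is a nonnegative real vector indexed by pairs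 ($i\in\mathcal I$, $f$ a flow whose path contains $i$). For $M\subset\mathcal L$, $z_M$ is the subvector of entries with $\ell\in M$. All comparisons are coordinatewise. Convergence means convergence to a finite limit. **Maps.** $\mathcal D(z)=(\mathcal D_i(z_{\mathrm{In}(i)}))_{i\in\mathcal I}$, where $\mathcal D_i$ is the network-calculus delay-jitter bound at node $i$. Each coordinate of $\mathcal D_i$ is finite-valued and is a minimum of finitely many affine functions of its argument (hence concave and continuous), $\mathcal D_i$ is isotonic (coordinatewise nondecreasing), and $\mathcal D(0)>0$ in every coordinate. The map $\mathcal Y$ is $\mathcal Y(d)_{\ell,f}=b_f+r_f\sum_{u\in \mathrm{Pred}_f(\ell)}d_u^f$. Set $\mathcal G(z,d)=(\mathcal Y(d),\mathcal D(z))$, acting on nonnegative vectors. **AsyncTFA.** Start with $(z^0,d^0)=(0,0)$. At round $k\ge1$, the nodes $i\in I_k$ are processed in parallel, with shared variable $d$: for each $i\in I_k$, $d_i^k=\mathcal D_i(z^{k-1}_{\mathrm{In}(i)})$, and for each $\ell\in\mathrm{Out}(i)$, $z^k_\ell$ is the value of $\mathcal Y_\ell$ (the $\ell$-component of $\mathcal Y$) evaluated at the values of $d$ present at the time of reading, i.e. $z^k_{\ell,f}=b_f+r_f\sum_{u\in\mathrm{Pred}_f(\ell)}\tilde d_u^f$ where each term $\tilde d_u^f$ is (nondeterministically, independently for each read) either the $(u,f)$ entry of $d^{k-1}$ or that of $d^k$. The updated burstinesses become available only at the end of the round. For nodes $i\notin I_k$, $d_i^k=d_i^{k-1}$ and $z_\ell^k=z_\ell^{k-1}$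 for $\ell\in\mathrm{Out}(i)$. *)

theory Defs
  imports "HOL-Analysis.Analysis"
begin

text \<open>
  A real vector indexed by a set A is a function that is extensional on A (constantly
  \<^const>\<open>undefined\<close> outside A). Two such functions agree outside A, so the pointwise order on
  functions is the coordinatewise order of vectors, and convergence in the product topology is
  coordinatewise convergence; the orders and topologies on pairs are the product ones.
\<close>

definition nonneg_vectors :: "'a set \<Rightarrow> ('a \<Rightarrow> real) set" where
  "nonneg_vectors A = A \<rightarrow>\<^sub>E {0..}"

definition zero_vector :: "'a set \<Rightarrow> 'a \<Rightarrow> real" where
  "zero_vector A = (\<lambda>p\<in>A. 0)"

definition min_of_affine :: "'a set \<Rightarrow> (('a \<Rightarrow> real) \<Rightarrow> real) \<Rightarrow> bool" where
  "min_of_affine A g \<longleftrightarrow>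
     (\<exists>S :: (('a \<Rightarrow> real) \<times> real) set. finite S \<and> S \<noteq> {} \<and>
        (\<forall>w \<in> nonneg_vectors A. g w = Min ((\<lambda>(c, a). a + (\<Sum>p\<in>A. c p * w p)) ` S)))"

record ('n, 'f) network =
  nodes :: "'n set"
  flows :: "'f set"
  rate :: "'f \<Rightarrow> real"
  burst :: "'f \<Rightarrow> real"
  route :: "'f \<Rightarrow> 'n list"

definition valid_network :: "('n, 'f) network \<Rightarrow> bool" where
  "valid_network N \<longleftrightarrow>
     finite (nodes N) \<and> finite (flows N) \<and>
     (\<forall>f \<in> flows N. 0 < rate N f \<and> 0 < burst N f \<and>
        distinct (route N f) \<and> set (route N f) \<subseteq> nodes N)"

definition carried_by :: "('n, 'f) network \<Rightarrow> 'f \<Rightarrow> 'n \<times> 'n \<Rightarrow> bool" where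
  "carried_by N f l \<longleftrightarrow>
     f \<in> flows N \<and>
     (\<exists>m. Suc m < length (route N f) \<and> l = (route N f ! m, route N f ! Suc m))"

definition transit_edges :: "('n, 'f) network \<Rightarrow> ('n \<times> 'n) set" where
  "transit_edges N = {l. \<exists>f. carried_by N f l}"

definition in_edges :: "('n, 'f) network \<Rightarrow> 'n \<Rightarrow> ('n \<times> 'n) set" where
  "in_edges N i = {l \<in> transit_edges N. snd l = i}"

definition out_edges :: "('n, 'f) network \<Rightarrow> 'n \<Rightarrow> ('n \<times> 'n) set" where
  "out_edges N i = {l \<in> transit_edges N. fst l = i}"

definition preds :: "('n, 'f) network \<Rightarrow> 'f \<Rightarrow> 'n \<times> 'n \<Rightarrow> 'n set" where
  "preds N f l =
     {route N f ! m | m n. m \<le> n \<and> n < length (route N f) \<and> route N f ! n = fst l}"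

definition z_index :: "('n, 'f) network \<Rightarrow> (('n \<times> 'n) \<times> 'f) set" where
  "z_index N = {(l, f). carried_by N f l}"

definition d_index :: "('n, 'f) network \<Rightarrow> ('n \<times> 'f) set" where
  "d_index N = {(i, f). i \<in> nodes N \<and> f \<in> flows N \<and> i \<in> set (route N f)}"

definition sub_index :: "('n, 'f) network \<Rightarrow> ('n \<times> 'n) set \<Rightarrow> (('n \<times> 'n) \<times> 'f) set" where
  "sub_index N M = {(l, f) \<in> z_index N. l \<in> M}"

text \<open>
  A family D of node maps takes a node i, a vector w indexed by the pairs (l, f) with l an
  edge entering i, and a flow f through i, and returns the delay-jitter bound of f at i.
  Of the network-calculus bound only the following properties are used; D is otherwise arbitrary.
\<close>

definition delay_jitter_maps ::
  "('n, 'f) network \<Rightarrow> ('n \<Rightarrow> (('n \<times> 'n) \<times> 'f \<Rightarrow> real) \<Rightarrow> 'f \<Rightarrow> real) \<Rightarrow> bool" where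
  "delay_jitter_maps N D \<longleftrightarrow>
     (\<forall>(i, f) \<in> d_index N.
        min_of_affine (sub_index N (in_edges N i)) (\<lambda>w. D i w f) \<and>
        mono_on (nonneg_vectors (sub_index N (in_edges N i))) (\<lambda>w. D i w f) \<and>
        0 < D i (zero_vector (sub_index N (in_edges N i))) f)"

definition delay_map ::
  "('n, 'f) network \<Rightarrow> ('n \<Rightarrow> (('n \<times> 'n) \<times> 'f \<Rightarrow> real) \<Rightarrow> 'f \<Rightarrow> real)
     \<Rightarrow> (('n \<times> 'n) \<times> 'f \<Rightarrow> real) \<Rightarrow> ('n \<times> 'f \<Rightarrow> real)" where
  "delay_map N D z = (\<lambda>(i, f) \<in> d_index N. D i (restrict z (sub_index N (in_edges N i))) f)"

definition burst_map ::
  "('n, 'f) network \<Rightarrow> ('n \<times> 'f \<Rightarrow> real) \<Rightarrow> (('n \<times> 'n) \<times> 'f \<Rightarrow> real)" where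
  "burst_map N d =
     (\<lambda>(l, f) \<in> z_index N. burst N f + rate N f * (\<Sum>u \<in> preds N f l. d (u, f)))"

definition G_map ::
  "('n, 'f) network \<Rightarrow> ('n \<Rightarrow> (('n \<times> 'n) \<times> 'f \<Rightarrow> real) \<Rightarrow> 'f \<Rightarrow> real)
     \<Rightarrow> (('n \<times> 'n) \<times> 'f \<Rightarrow> real) \<times> ('n \<times> 'f \<Rightarrow> real)
     \<Rightarrow> (('n \<times> 'n) \<times> 'f \<Rightarrow> real) \<times> ('n \<times> 'f \<Rightarrow> real)" where
  "G_map N D = (\<lambda>(z, d). (burst_map N d, delay_map N D z))"

definition Low ::
  "('n, 'f) network \<Rightarrow> ('n \<Rightarrow> (('n \<times> 'n) \<times> 'f \<Rightarrow> real) \<Rightarrow> 'f \<Rightarrow> real)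
     \<Rightarrow> ((('n \<times> 'n) \<times> 'f \<Rightarrow> real) \<times> ('n \<times> 'f \<Rightarrow> real)) set" where
  "Low N D =
     {x \<in> nonneg_vectors (z_index N) \<times> nonneg_vectors (d_index N). x \<le> G_map N D x}"

definition bounded_vectors ::
  "('n, 'f) network \<Rightarrow> ((('n \<times> 'n) \<times> 'f \<Rightarrow> real) \<times> ('n \<times> 'f \<Rightarrow> real)) set \<Rightarrow> bool" where
  "bounded_vectors N S \<longleftrightarrow>
     (\<exists>B. \<forall>(z, d) \<in> S. (\<forall>p \<in> z_index N. \<bar>z p\<bar> \<le> B) \<and> (\<forall>q \<in> d_index N. \<bar>d q\<bar> \<le> B))"

text \<open>
  One round, processing the nodes in A in parallel, from (z, d) to (z', d'). The shared variable
  d may be read before or after any of its entries is overwritten: the function e below collects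
  the values read when computing the entry (l, f), so the choice of old or new value is
  independent for each (l, f) and each u.
\<close>

definition async_round ::
  "('n, 'f) network \<Rightarrow> ('n \<Rightarrow> (('n \<times> 'n) \<times> 'f \<Rightarrow> real) \<Rightarrow> 'f \<Rightarrow> real) \<Rightarrow> 'n set
     \<Rightarrow> (('n \<times> 'n) \<times> 'f \<Rightarrow> real) \<Rightarrow> ('n \<times> 'f \<Rightarrow> real)
     \<Rightarrow> (('n \<times> 'n) \<times> 'f \<Rightarrow> real) \<Rightarrow> ('n \<times> 'f \<Rightarrow> real) \<Rightarrow> bool" where
  "async_round N D A z d z' d' \<longleftrightarrow>
     z' \<in> extensional (z_index N) \<and> d' \<in> extensional (d_index N) \<and>
     (\<forall>(i, f) \<in> d_index N.
        d' (i, f) = (if i \<in> A then D i (restrict z (sub_index N (in_edges N i))) f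
                     else d (i, f))) \<and>
     (\<forall>i \<in> nodes N. \<forall>(l, f) \<in> sub_index N (out_edges N i).
        if i \<in> A
        then \<exists>e. (\<forall>u \<in> preds N f l. e u = d (u, f) \<or> e u = d' (u, f)) \<and>
                 z' (l, f) = burst N f + rate N f * (\<Sum>u \<in> preds N f l. e u)
        else z' (l, f) = z (l, f))"

definition async_tfa ::
  "('n, 'f) network \<Rightarrow> ('n \<Rightarrow> (('n \<times> 'n) \<times> 'f \<Rightarrow> real) \<Rightarrow> 'f \<Rightarrow> real) \<Rightarrow> (nat \<Rightarrow> 'n set)
     \<Rightarrow> (nat \<Rightarrow> ('n \<times> 'n) \<times> 'f \<Rightarrow> real) \<Rightarrow> (nat \<Rightarrow> 'n \<times> 'f \<Rightarrow> real) \<Rightarrow> bool" where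
  "async_tfa N D J z d \<longleftrightarrow>
     z 0 = zero_vector (z_index N) \<and> d 0 = zero_vector (d_index N) \<and>
     (\<forall>k \<ge> 1. async_round N D (J k) (z (k - 1)) (d (k - 1)) (z k) (d k))"

end

theory Submission
  imports Defs
begin

text \<open>
  Every iterate stays in Low, since replacing some coordinates of a point of Low by values between
  the current one and the one prescribed by G moves up inside Low; so the iterates increase. If they
  converge, fairness and continuity make the limit a fixed point x of G. As G is isotonic, concave
  and positive at 0, it satisfies t G(y) < G(t y) for 0 \<le> t < 1, so x dominates Low: otherwise,
  for y in Low with y \<le> x false, the largest t with t y \<le> x is below 1, and
  t y \<le> t G(y) < G(t y) \<le> G(x) = x in every coordinate contradicts its maximality.
  Hence convergence forces Low to be bounded; conversely bounded increasing iterates converge.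
\<close>

section \<open>Coordinatewise limits and limits of finite minima\<close>

lemma tendsto_fun_iff:
  fixes X :: "nat \<Rightarrow> 'a \<Rightarrow> real"
  shows "X \<longlonglongrightarrow> L \<longleftrightarrow> (\<forall>p. (\<lambda>k. X k p) \<longlonglongrightarrow> L p)"
proof -
  have "X \<longlonglongrightarrow> L \<longleftrightarrow> limitin (product_topology (\<lambda>_. euclidean) UNIV) X L sequentially"
    by (simp add: euclidean_product_topology)
  then show ?thesis
    by (simp add: limitin_componentwise)
qed

lemma tendsto_Min_image:
  fixes h :: "'s \<Rightarrow> 'b \<Rightarrow> real"
  assumes "finite S" "S \<noteq> {}" "\<And>s. s \<in> S \<Longrightarrow> (h s \<longlongrightarrow> l s) F"
  shows "((\<lambda>k. Min ((\<lambda>s. h s k) ` S)) \<longlongrightarrow> Min (l ` S)) F"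
  using assms
proof (induction S rule: finite_ne_induct)
  case (insert s S)
  then show ?case
    by (simp add: tendsto_min)
qed simp

section \<open>Nonnegative vectors over an index set: order and limits\<close>

lemma nonneg_vectors_iff:
  "x \<in> nonneg_vectors A \<longleftrightarrow> x \<in> extensional A \<and> (\<forall>p\<in>A. 0 \<le> x p)"
  by (auto simp: nonneg_vectors_def PiE_iff)

lemma zero_vector_nonneg: "zero_vector A \<in> nonneg_vectors A"
  by (simp add: nonneg_vectors_iff zero_vector_def)

lemma restrict_nonneg_vectors:
  assumes "x \<in> nonneg_vectors A" "B \<subseteq> A"
  shows "restrict x B \<in> nonneg_vectors B"
  using assms by (auto simp: nonneg_vectors_iff)

lemma scale_nonneg_vectors:
  assumes "x \<in> nonneg_vectors A" "0 \<le> t"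
  shows "(\<lambda>p\<in>A. t * x p) \<in> nonneg_vectors A"
  using assms by (auto simp: nonneg_vectors_iff)

text \<open>Off \<open>A\<close> both functions take the value \<open>undefined\<close>, so only
  coordinates in \<open>A\<close> can break the inequality.\<close>

lemma extensional_le_iff:
  fixes x y :: "'a \<Rightarrow> real"
  assumes "x \<in> extensional A" "y \<in> extensional A"
  shows "x \<le> y \<longleftrightarrow> (\<forall>p\<in>A. x p \<le> y p)"
proof
  assume le: "\<forall>p\<in>A. x p \<le> y p"
  show "x \<le> y"
  proof (rule le_funI)
    fix p show "x p \<le> y p"
      using le assms by (cases "p \<in> A") (auto simp: extensional_def)
  qed
qed (auto simp: le_fun_def)

lemma nonneg_vectors_limit:
  assumes X: "\<And>k. X k \<in> nonneg_vectors A" and lim: "X \<longlonglongrightarrow> L"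
  shows "L \<in> nonneg_vectors A"
  unfolding nonneg_vectors_iff extensional_def
proof (intro conjI CollectI allI impI ballI)
  fix p
  have limp: "(\<lambda>k. X k p) \<longlonglongrightarrow> L p"
    using lim unfolding tendsto_fun_iff by blast
  show "0 \<le> L p" if "p \<in> A"
    using X that by (intro LIMSEQ_le_const[OF limp]) (simp add: nonneg_vectors_iff)
  \<comment> \<open>Off \<open>A\<close> the sequence is constantly \<open>undefined\<close>, and
    limits are unique, so \<open>L\<close> stays extensional.\<close>
  show "L p = undefined" if "p \<notin> A"
    using limp PiE_arb[OF X[unfolded nonneg_vectors_def] that] by (simp add: LIMSEQ_const_iff)
qed

section \<open>Minima of affine functions and the scaling argument\<close>

lemma min_of_affine_tendsto:
  assumes g: "min_of_affine A g" and X: "\<And>k. X k \<in> nonneg_vectors A" and L: "L \<in> nonneg_vectors A"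
    and lim: "\<And>p. p \<in> A \<Longrightarrow> (\<lambda>k. X k p) \<longlonglongrightarrow> L p"
  shows "(\<lambda>k. g (X k)) \<longlonglongrightarrow> g L"
proof -
  obtain S :: "(('a \<Rightarrow> real) \<times> real) set" where S: "finite S" "S \<noteq> {}"
    and g_eq: "\<And>w. w \<in> nonneg_vectors A \<Longrightarrow>
      g w = Min ((\<lambda>(c, a). a + (\<Sum>p\<in>A. c p * w p)) ` S)"
    using g unfolding min_of_affine_def by blast
  \<comment> \<open>The minimum is written with a function of \<open>k\<close> chosen by the pair
    \<open>s\<close>, so that it is an instance of \<open>h s k\<close> in
    \<open>tendsto_Min_image\<close>.\<close>
  have "(\<lambda>k. Min ((\<lambda>s. (case s of (c, a) \<Rightarrow> \<lambda>k. a + (\<Sum>p\<in>A. c p * X k p)) k) ` S))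
      \<longlonglongrightarrow> Min ((\<lambda>(c, a). a + (\<Sum>p\<in>A. c p * L p)) ` S)"
    using S by (rule tendsto_Min_image) (auto intro!: tendsto_intros lim)
  then show ?thesis
    by (simp add: g_eq X L case_prod_beta)
qed

text \<open>Concavity along the segment from 0 to \<open>w\<close> gives g(t w) \<ge> t g(w) + (1 -
  t) g(0), and the last term is positive. The proof checks this on each affine piece
  separately.\<close>

lemma min_of_affine_strict_scale:
  assumes g: "min_of_affine A g" and w: "w \<in> nonneg_vectors A"
    and t: "0 \<le> t" "t < 1" and pos: "0 < g (zero_vector A)"
  shows "t * g w < g (\<lambda>p\<in>A. t * w p)"
proof -
  obtain S :: "(('a \<Rightarrow> real) \<times> real) set" where S: "finite S" "S \<noteq> {}"
    and g_eq: "\<And>w. w \<in> nonneg_vectors A \<Longrightarrow>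
      g w = Min ((\<lambda>(c, a). a + (\<Sum>p\<in>A. c p * w p)) ` S)"
    using g unfolding min_of_affine_def by blast
  have tw: "(\<lambda>p\<in>A. t * w p) \<in> nonneg_vectors A"
    using w t by (simp add: scale_nonneg_vectors)
  have "t * g w < a + (\<Sum>p\<in>A. c p * (t * w p))" if ca: "(c, a) \<in> S" for c a
  proof -
    have "g w \<le> a + (\<Sum>p\<in>A. c p * w p)"
      using S ca by (auto simp: g_eq[OF w] intro!: Min_le)
    \<comment> \<open>At the zero vector the piece \<open>(c, a)\<close> has the value
      \<open>a\<close>.\<close>
    moreover have "g (zero_vector A) \<le> a"
      unfolding g_eq[OF zero_vector_nonneg]
      using S ca by (intro Min_le image_eqI[of _ _ "(c, a)"]) (auto simp: zero_vector_def)
    ultimately have "t * g w + (1 - t) * g (zero_vector A) \<le>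
        t * (a + (\<Sum>p\<in>A. c p * w p)) + (1 - t) * a"
      using t by (intro add_mono mult_left_mono) auto
    also have "\<dots> = a + (\<Sum>p\<in>A. c p * (t * w p))"
      by (simp add: algebra_simps sum_distrib_left)
    finally show ?thesis
      using mult_pos_pos[of "1 - t" "g (zero_vector A)"] t pos by linarith
  qed
  \<comment> \<open>The minimum over the finite nonempty \<open>S\<close> is attained, so the strict
    bound on every piece passes to it.\<close>
  then show ?thesis
    using S by (auto simp: g_eq[OF tw])
qed

text \<open>Shrink \<open>y\<close> until it just fits under \<open>x\<close>: the critical factor
  is the least ratio x p / y p, and a coordinate attaining it is where the two touch. The violated
  coordinate \<open>q\<close> has ratio below 1.\<close>

lemma exists_touching_scale:
  fixes x y :: "'a \<Rightarrow> real"
  assumes fin: "finite A" and x: "\<And>p. p \<in> A \<Longrightarrow> 0 < x p" and q: "q \<in> A" "x q < y q"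
  obtains t p where "0 \<le> t" "t < 1" "p \<in> A" "t * y p = x p" "\<And>p. p \<in> A \<Longrightarrow> t * y p \<le> x p"
proof -
  \<comment> \<open>Only these coordinates restrict the factor: where y p \<le> 0, a positive factor
    keeps t y p \<le> 0 < x p.\<close>
  define P where "P = {p \<in> A. 0 < y p}"
  define t where "t = Min ((\<lambda>p. x p / y p) ` P)"
  have P: "finite P" "q \<in> P"
    using fin q x[of q] by (auto simp: P_def)
  have "t \<in> (\<lambda>p. x p / y p) ` P"
    unfolding t_def using P by (intro Min_in) auto
  then obtain p where p: "p \<in> P" "t = x p / y p"
    by blast
  have t_le: "t \<le> x r / y r" if "r \<in> P" for r
    unfolding t_def using P that by (intro Min_le) auto
  have t0: "0 < t"
    using p x by (simp add: P_def)
  show thesis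
  proof
    show "0 \<le> t" "p \<in> A" "t * y p = x p"
      using t0 p by (auto simp: P_def)
    have "x q / y q < 1"
      using P q by (simp add: P_def)
    then show "t < 1"
      using t_le[OF P(2)] by linarith
    fix r assume r: "r \<in> A"
    show "t * y r \<le> x r"
    proof (cases "0 < y r")
      case True
      then show ?thesis
        using t_le[of r] r by (simp add: P_def pos_le_divide_eq)
    next
      case False
      then have "t * y r \<le> 0"
        using t0 by (simp add: mult_nonneg_nonpos)
      then show ?thesis
        using x[OF r] by linarith
    qed
  qed
qed

section \<open>Index sets of the network\<close>

lemma finite_z_index:
  assumes "valid_network N"
  shows "finite (z_index N)"
proof -
  have "z_index N \<subseteq> (nodes N \<times> nodes N) \<times> flows N"
    using assms unfolding z_index_def carried_by_def valid_network_def
    by (auto dest!: bspec simp: subset_iff)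
  then show ?thesis
    using assms by (auto simp: valid_network_def dest: finite_subset)
qed

lemma finite_d_index:
  assumes "valid_network N"
  shows "finite (d_index N)"
proof -
  have "d_index N \<subseteq> nodes N \<times> flows N"
    by (auto simp: d_index_def)
  then show ?thesis
    using assms by (auto simp: valid_network_def dest: finite_subset)
qed

lemma sub_index_subset: "sub_index N M \<subseteq> z_index N"
  by (auto simp: sub_index_def)

text \<open>Rounds prescribe burstiness node by node over outgoing edges; this locates the rule
  governing a given entry, namely that of the tail node \<open>fst l\<close>.\<close>

lemma z_index_out_edges:
  assumes "valid_network N" "(l, f) \<in> z_index N"
  shows "fst l \<in> nodes N" "(l, f) \<in> sub_index N (out_edges N (fst l))"
  using assms
  by (auto simp: z_index_def sub_index_def out_edges_def transit_edges_def carried_by_def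
      valid_network_def subset_iff)

text \<open>Every entry of \<open>d\<close> read by \<open>burst_map\<close> is a genuine
  coordinate, never an \<open>undefined\<close> value off the index set.\<close>

lemma preds_d_index:
  assumes "valid_network N" "(l, f) \<in> z_index N" "u \<in> preds N f l"
  shows "(u, f) \<in> d_index N"
proof -
  have "u \<in> set (route N f)"
    using assms(3) by (auto simp: preds_def)
  then show ?thesis
    using assms by (auto simp: z_index_def carried_by_def d_index_def valid_network_def)
qed

lemma z_index_flow:
  assumes "valid_network N" "(l, f) \<in> z_index N"
  shows "0 < rate N f" "0 < burst N f"
  using assms by (auto simp: z_index_def carried_by_def valid_network_def)

section \<open>Monotonicity, strict scaling and continuity of the two component maps\<close>

lemma burst_map_extensional [simp]: "burst_map N d \<in> extensional (z_index N)"
  by (auto simp: burst_map_def)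

lemma delay_map_extensional [simp]: "delay_map N D z \<in> extensional (d_index N)"
  by (auto simp: delay_map_def)

lemma burst_map_mono:
  assumes "valid_network N" "d \<le> d'"
  shows "burst_map N d \<le> burst_map N d'"
proof -
  have "burst_map N d (l, f) \<le> burst_map N d' (l, f)" if "(l, f) \<in> z_index N" for l f
    using that assms z_index_flow[OF assms(1) that]
    by (auto simp: burst_map_def le_fun_def intro!: mult_left_mono sum_mono)
  then show ?thesis
    by (subst extensional_le_iff[where A = "z_index N"]) auto
qed

text \<open>The sum of delays scales linearly while the source burstiness is not scaled, which
  leaves a gap of (1 - t) \<open>burst N f\<close> > 0.\<close>

lemma burst_map_strict_scale:
  assumes N: "valid_network N" and p: "p \<in> z_index N" and t: "t < 1"
  shows "t * burst_map N d p < burst_map N (\<lambda>q\<in>d_index N. t * d q) p"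
proof -
  obtain l f where lf: "p = (l, f)" by (cases p)
  have "(\<Sum>u\<in>preds N f l. (\<lambda>q\<in>d_index N. t * d q) (u, f)) = t * (\<Sum>u\<in>preds N f l. d (u, f))"
    using preds_d_index[OF N] p by (simp add: lf sum_distrib_left)
  moreover have "t * burst N f < burst N f"
    using z_index_flow[OF N] p t by (simp add: lf)
  ultimately show ?thesis
    using p by (simp add: lf burst_map_def algebra_simps)
qed

lemma delay_jitter_mapsD:
  assumes "delay_jitter_maps N D" "(i, f) \<in> d_index N"
  shows "min_of_affine (sub_index N (in_edges N i)) (\<lambda>w. D i w f)"
    and "mono_on (nonneg_vectors (sub_index N (in_edges N i))) (\<lambda>w. D i w f)"
    and "0 < D i (zero_vector (sub_index N (in_edges N i))) f"
  using assms by (auto simp: delay_jitter_maps_def)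

lemma delay_map_mono:
  assumes D: "delay_jitter_maps N D"
    and z: "z \<in> nonneg_vectors (z_index N)" "z' \<in> nonneg_vectors (z_index N)" "z \<le> z'"
  shows "delay_map N D z \<le> delay_map N D z'"
proof -
  have "delay_map N D z (i, f) \<le> delay_map N D z' (i, f)" if i: "(i, f) \<in> d_index N" for i f
  proof -
    let ?A = "sub_index N (in_edges N i)"
    have "restrict z ?A \<le> restrict z' ?A"
      using z(3) by (auto simp: le_fun_def restrict_def)
    then have "D i (restrict z ?A) f \<le> D i (restrict z' ?A) f"
      using mono_onD[OF delay_jitter_mapsD(2)[OF D i]] z sub_index_subset
        restrict_nonneg_vectors by metis
    then show ?thesis
      using i by (simp add: delay_map_def)
  qed
  then show ?thesis
    by (subst extensional_le_iff[where A = "d_index N"]) auto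
qed

lemma delay_map_strict_scale:
  assumes D: "delay_jitter_maps N D" and q: "q \<in> d_index N"
    and z: "z \<in> nonneg_vectors (z_index N)" and t: "0 \<le> t" "t < 1"
  shows "t * delay_map N D z q < delay_map N D (\<lambda>p\<in>z_index N. t * z p) q"
proof -
  obtain i f where q_eq: "q = (i, f)" by (cases q)
  let ?A = "sub_index N (in_edges N i)"
  have i: "(i, f) \<in> d_index N"
    using q q_eq by simp
  have "t * D i (restrict z ?A) f < D i (\<lambda>p\<in>?A. t * restrict z ?A p) f"
    using min_of_affine_strict_scale[OF delay_jitter_mapsD(1)[OF D i]
        restrict_nonneg_vectors[OF z sub_index_subset] t delay_jitter_mapsD(3)[OF D i]] .
  \<comment> \<open>Scaling commutes with restriction to the entries entering \<open>i\<close>,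
    since these all lie in \<open>z_index N\<close>.\<close>
  moreover have "(\<lambda>p\<in>?A. t * restrict z ?A p) = restrict (\<lambda>p\<in>z_index N. t * z p) ?A"
    using sub_index_subset[of N "in_edges N i"] by (auto simp: fun_eq_iff restrict_def)
  ultimately show ?thesis
    using i q_eq by (simp add: delay_map_def)
qed

lemma burst_map_tendsto:
  assumes N: "valid_network N" and p: "p \<in> z_index N"
    and lim: "\<And>q. q \<in> d_index N \<Longrightarrow> (\<lambda>k. d k q) \<longlonglongrightarrow> d' q"
  shows "(\<lambda>k. burst_map N (d k) p) \<longlonglongrightarrow> burst_map N d' p"
proof -
  obtain l f where lf: "p = (l, f)" by (cases p)
  show ?thesis
    using p by (auto simp: lf burst_map_def intro!: tendsto_intros lim preds_d_index[OF N, of l f])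
qed

lemma delay_map_tendsto:
  assumes D: "delay_jitter_maps N D" and q: "q \<in> d_index N"
    and z: "\<And>k. z k \<in> nonneg_vectors (z_index N)" "z' \<in> nonneg_vectors (z_index N)"
    and lim: "\<And>p. p \<in> z_index N \<Longrightarrow> (\<lambda>k. z k p) \<longlonglongrightarrow> z' p"
  shows "(\<lambda>k. delay_map N D (z k) q) \<longlonglongrightarrow> delay_map N D z' q"
proof -
  obtain i f where q_eq: "q = (i, f)" by (cases q)
  let ?A = "sub_index N (in_edges N i)"
  have i: "(i, f) \<in> d_index N"
    using q q_eq by simp
  have "(\<lambda>k. D i (restrict (z k) ?A) f) \<longlonglongrightarrow> D i (restrict z' ?A) f"
    using sub_index_subset[of N "in_edges N i"]
    by (intro min_of_affine_tendsto[OF delay_jitter_mapsD(1)[OF D i]])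
      (auto intro!: lim restrict_nonneg_vectors[OF z(1)] restrict_nonneg_vectors[OF z(2)])
  then show ?thesis
    using i q_eq by (simp add: delay_map_def)
qed

section \<open>The set \<open>Low\<close> and points dominating it\<close>

lemma Low_iff:
  "(z, d) \<in> Low N D \<longleftrightarrow> z \<in> nonneg_vectors (z_index N) \<and> d \<in> nonneg_vectors (d_index N) \<and>
     z \<le> burst_map N d \<and> d \<le> delay_map N D z"
  by (auto simp: Low_def G_map_def)

text \<open>Domination is proved for any nonnegative point that G maps below itself, the half of the
  fixed-point property which the scaling argument uses.\<close>

lemma Low_le_postfixed:
  assumes N: "valid_network N" and D: "delay_jitter_maps N D"
    and low: "(y, e) \<in> Low N D"
    and z: "z \<in> nonneg_vectors (z_index N)" and d: "d \<in> nonneg_vectors (d_index N)"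
    and post: "burst_map N d \<le> z" "delay_map N D z \<le> d"
  shows "(y, e) \<le> (z, d)"
proof (rule ccontr)
  have y: "y \<in> nonneg_vectors (z_index N)" and e: "e \<in> nonneg_vectors (d_index N)"
    and ye: "y \<le> burst_map N e" "e \<le> delay_map N D y"
    using low by (auto simp: Low_iff)

  \<comment> \<open>As soon as the scaled point lies below \<open>(z, d)\<close>, it lies strictly
    below in every coordinate, so no coordinate can touch.\<close>
  have strict: "(\<forall>p\<in>z_index N. t * y p < z p) \<and> (\<forall>q\<in>d_index N. t * e q < d q)"
    if t: "0 \<le> t" "t < 1" and le: "\<forall>p\<in>z_index N. t * y p \<le> z p" "\<forall>q\<in>d_index N. t * e q \<le> d q"
    for t
  proof (intro conjI ballI)
    have ty: "(\<lambda>p\<in>z_index N. t * y p) \<le> z" and te: "(\<lambda>q\<in>d_index N. t * e q) \<le> d"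
      using z d le
      by (auto simp: nonneg_vectors_iff extensional_le_iff[where A = "z_index N"]
          extensional_le_iff[where A = "d_index N"])
    show "t * y p < z p" if p: "p \<in> z_index N" for p
    proof -
      have "t * y p \<le> t * burst_map N e p"
        using t by (intro mult_left_mono le_funD[OF ye(1)])
      also have "\<dots> < burst_map N (\<lambda>q\<in>d_index N. t * e q) p"
        using N p t(2) by (rule burst_map_strict_scale)
      also have "\<dots> \<le> burst_map N d p"
        using burst_map_mono[OF N te] by (rule le_funD)
      also have "\<dots> \<le> z p"
        using post(1) by (rule le_funD)
      finally show ?thesis .
    qed
    show "t * e q < d q" if q: "q \<in> d_index N" for q
    proof -
      have "t * e q \<le> t * delay_map N D y q"
        using t by (intro mult_left_mono le_funD[OF ye(2)])
      also have "\<dots> < delay_map N D (\<lambda>p\<in>z_index N. t * y p) q"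
        using D q y t by (rule delay_map_strict_scale)
      also have "\<dots> \<le> delay_map N D z q"
        using delay_map_mono[OF D scale_nonneg_vectors[OF y t(1)] z ty] by (rule le_funD)
      also have "\<dots> \<le> d q"
        using post(2) by (rule le_funD)
      finally show ?thesis .
    qed
  qed
  \<comment> \<open>Both components are joined over a disjoint sum, so that a single factor
    \<open>t\<close> serves all coordinates.\<close>
  let ?A = "z_index N <+> d_index N" and ?x = "case_sum z d" and ?y = "case_sum y e"
  \<comment> \<open>For t = 0 the premises of \<open>strict\<close> reduce to nonnegativity, and its
    conclusion is positivity of \<open>z\<close> and \<open>d\<close>.\<close>
  have pos: "0 < ?x s" if "s \<in> ?A" for s
    using strict[of 0] z d that by (auto simp: nonneg_vectors_iff)
  assume "\<not> (y, e) \<le> (z, d)"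
  then have "\<exists>s\<in>?A. ?x s < ?y s"
    using y e z d
    by (auto simp: nonneg_vectors_iff extensional_le_iff[where A = "z_index N"]
        extensional_le_iff[where A = "d_index N"] not_le Plus_def bex_Un)
  then obtain s where s: "s \<in> ?A" "?x s < ?y s" ..
  have "finite ?A"
    using finite_z_index[OF N] finite_d_index[OF N] by simp
  from exists_touching_scale[where x = ?x and y = ?y, OF this pos s] obtain t r where t: "0 \<le> t" "t < 1"
    and r: "r \<in> ?A" "t * ?y r = ?x r" and le: "\<And>s. s \<in> ?A \<Longrightarrow> t * ?y s \<le> ?x s"
    by metis
  \<comment> \<open>Strictness everywhere contradicts the equality at the touching coordinate
    \<open>r\<close>.\<close>
  have "(\<forall>p\<in>z_index N. t * y p < z p) \<and> (\<forall>q\<in>d_index N. t * e q < d q)"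
    using strict[OF t] le[OF InlI] le[OF InrI] by simp
  then show False
    using r by (auto simp: Plus_def)
qed

section \<open>Rounds of AsyncTFA inside \<open>Low\<close>\<close>

text \<open>A processed node writes exactly D(z) into \<open>d'\<close> and something between Y(d)
  and Y(d') into \<open>z'\<close>; with z \<le> Y(d) and d \<le> D(z) this moves up and stays in
  \<open>Low\<close>. The last two conclusions record that a processed entry reaches at least the
  value of G at the old point, as needed for the fairness argument.\<close>

lemma async_round_step:
  assumes N: "valid_network N" and D: "delay_jitter_maps N D"
    and low: "(z, d) \<in> Low N D" and round: "async_round N D A z d z' d'"
  shows "(z', d') \<in> Low N D" and "(z, d) \<le> (z', d')"
    and "\<And>l f. (l, f) \<in> z_index N \<Longrightarrow> fst l \<in> A \<Longrightarrow> burst_map N d (l, f) \<le> z' (l, f)"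
    and "\<And>i f. (i, f) \<in> d_index N \<Longrightarrow> i \<in> A \<Longrightarrow> delay_map N D z (i, f) \<le> d' (i, f)"
proof -
  have z: "z \<in> nonneg_vectors (z_index N)" and d: "d \<in> nonneg_vectors (d_index N)"
    and zd: "z \<le> burst_map N d" "d \<le> delay_map N D z"
    using low by (auto simp: Low_iff)
  have ext: "z' \<in> extensional (z_index N)" "d' \<in> extensional (d_index N)"
    and d'_eq: "\<And>i f. (i, f) \<in> d_index N \<Longrightarrow>
      d' (i, f) = (if i \<in> A then delay_map N D z (i, f) else d (i, f))"
    using round by (auto simp: async_round_def delay_map_def)
  have "d q \<le> d' q \<and> d' q \<le> delay_map N D z q" if "q \<in> d_index N" for q
    using that le_funD[OF zd(2)] d'_eq by (cases q) auto
  then have d': "d \<le> d'" "d' \<le> delay_map N D z"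
    using d ext by (auto simp: nonneg_vectors_iff extensional_le_iff[where A = "d_index N"])
  have z'_bounds: "(if fst l \<in> A then burst_map N d (l, f) else z (l, f)) \<le> z' (l, f) \<and>
      z' (l, f) \<le> burst_map N d' (l, f)" if lf: "(l, f) \<in> z_index N" for l f
  proof (cases "fst l \<in> A")
    case False
    then have "z' (l, f) = z (l, f)"
      using round z_index_out_edges[OF N lf] by (fastforce simp: async_round_def)
    then show ?thesis
      using False order_trans[OF le_funD[OF zd(1)] le_funD[OF burst_map_mono[OF N d'(1)]]] by simp
  next
    case True
    then obtain e where e: "\<forall>u \<in> preds N f l. e u = d (u, f) \<or> e u = d' (u, f)"
      "z' (l, f) = burst N f + rate N f * (\<Sum>u \<in> preds N f l. e u)"
      using round z_index_out_edges[OF N lf] by (fastforce simp: async_round_def)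
    \<comment> \<open>Since d \<le> d', each read is trapped between the old and the new entry,
      whatever the nondeterministic choices.\<close>
    have "d (u, f) \<le> e u \<and> e u \<le> d' (u, f)" if "u \<in> preds N f l" for u
      using e(1) le_funD[OF d'(1), of "(u, f)"] that by auto
    then show ?thesis
      using True lf z_index_flow[OF N lf]
      by (auto simp: burst_map_def e(2) intro!: mult_left_mono sum_mono)
  qed
  have zz': "z p \<le> z' p \<and> z' p \<le> burst_map N d' p" if "p \<in> z_index N" for p
    using that z'_bounds[of "fst p" "snd p"] le_funD[OF zd(1), of p]
    by (cases p) (auto split: if_splits)
  then have z': "z \<le> z'" "z' \<le> burst_map N d'"
    using z ext by (auto simp: nonneg_vectors_iff extensional_le_iff[where A = "z_index N"])
  then show "(z, d) \<le> (z', d')"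
    using d' by simp
  have z'0: "z' \<in> nonneg_vectors (z_index N)" and d'0: "d' \<in> nonneg_vectors (d_index N)"
    using z d ext le_funD[OF z'(1)] le_funD[OF d'(1)]
    by (auto simp: nonneg_vectors_iff intro: order_trans)
  \<comment> \<open>The delays were computed from the old \<open>z\<close>; isotonicity carries the
    bound over to \<open>z'\<close>.\<close>
  have "d' \<le> delay_map N D z'"
    using d'(2) delay_map_mono[OF D z z'0 z'(1)] by (rule order_trans)
  then show "(z', d') \<in> Low N D"
    using z'0 d'0 z' by (simp add: Low_iff)
  show "burst_map N d (l, f) \<le> z' (l, f)" if "(l, f) \<in> z_index N" "fst l \<in> A" for l f
    using z'_bounds[OF that(1)] that by simp
  show "delay_map N D z (i, f) \<le> d' (i, f)" if "(i, f) \<in> d_index N" "i \<in> A" for i f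
    using d'_eq[OF that(1)] that by simp
qed

lemma zero_in_Low:
  assumes N: "valid_network N" and D: "delay_jitter_maps N D"
  shows "(zero_vector (z_index N), zero_vector (d_index N)) \<in> Low N D"
proof -
  \<comment> \<open>Strict scaling with t = 0 yields positivity at the zero vector; the vector
    scaled is arbitrary, hence the instance \<open>undefined\<close>.\<close>
  have "0 \<le> burst_map N (zero_vector (d_index N)) p" if "p \<in> z_index N" for p
    using burst_map_strict_scale[OF N that, of 0 undefined] by (simp add: zero_vector_def)
  moreover have "0 \<le> delay_map N D (zero_vector (z_index N)) q" if "q \<in> d_index N" for q
    using delay_map_strict_scale[OF D that zero_vector_nonneg, of 0] by (simp add: zero_vector_def)
  ultimately show ?thesis
    by (auto simp: Low_iff nonneg_vectors_iff extensional_le_iff[where A = "z_index N"]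
        extensional_le_iff[where A = "d_index N"] zero_vector_def)
qed

lemma async_tfa_step:
  assumes N: "valid_network N" and D: "delay_jitter_maps N D" and run: "async_tfa N D J z d"
  shows "(z k, d k) \<in> Low N D" and "(z k, d k) \<le> (z (Suc k), d (Suc k))"
    and "\<And>l f. (l, f) \<in> z_index N \<Longrightarrow> fst l \<in> J (Suc k) \<Longrightarrow>
      burst_map N (d k) (l, f) \<le> z (Suc k) (l, f)"
    and "\<And>i f. (i, f) \<in> d_index N \<Longrightarrow> i \<in> J (Suc k) \<Longrightarrow>
      delay_map N D (z k) (i, f) \<le> d (Suc k) (i, f)"
proof -
  \<comment> \<open>Rounds are numbered from 1, so round \<open>Suc k\<close> leads from iterate
    \<open>k\<close> to iterate \<open>Suc k\<close>.\<close>
  have round: "async_round N D (J (Suc k)) (z k) (d k) (z (Suc k)) (d (Suc k))" for k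
    using run unfolding async_tfa_def by (metis diff_Suc_1 le_add1 plus_1_eq_Suc)
  have low: "(z k, d k) \<in> Low N D" for k
  proof (induction k)
    case 0
    then show ?case
      using run zero_in_Low[OF N D] by (simp add: async_tfa_def)
  qed (rule async_round_step(1)[OF N D _ round])
  then show "(z k, d k) \<in> Low N D" .
  note step = async_round_step[OF N D low round]
  show "(z k, d k) \<le> (z (Suc k), d (Suc k))"
    by (rule step(2))
  show "\<And>l f. (l, f) \<in> z_index N \<Longrightarrow> fst l \<in> J (Suc k) \<Longrightarrow>
      burst_map N (d k) (l, f) \<le> z (Suc k) (l, f)"
    by (rule step(3))
  show "\<And>i f. (i, f) \<in> d_index N \<Longrightarrow> i \<in> J (Suc k) \<Longrightarrow>
      delay_map N D (z k) (i, f) \<le> d (Suc k) (i, f)"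
    by (rule step(4))
qed

lemma async_tfa_incseq:
  assumes "valid_network N" "delay_jitter_maps N D" "async_tfa N D J z d"
  shows "incseq (\<lambda>k. (z k, d k))" "incseq z" "incseq d"
  using async_tfa_step(2)[OF assms] by (auto intro!: incseq_SucI)

section \<open>Limits of fair runs\<close>

text \<open>Here \<open>a\<close> is an entry of the iterates and \<open>b\<close> its target under
  G. Any \<open>m\<close> is followed by an update round \<open>Suc n\<close> with n \<ge> m, where
  b m \<le> b n \<le> a (Suc n) \<le> a'; the one-round delay is absorbed by monotonicity of
  \<open>b\<close>.\<close>

lemma limit_ge_of_frequently:
  fixes a b c :: "nat \<Rightarrow> real"
  assumes a: "incseq a" "a \<longlonglongrightarrow> a'" and b: "\<And>m n. m \<le> n \<Longrightarrow> b m \<le> b n" "b \<longlonglongrightarrow> b'"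
    and inf: "infinite {k. k \<ge> 1 \<and> P k}" and upd: "\<And>k. P (Suc k) \<Longrightarrow> b k \<le> a (Suc k)"
  shows "b' \<le> a'"
proof (rule LIMSEQ_le_const2[OF b(2)])
  have "b m \<le> a'" for m
  proof -
    obtain k where k: "m < k" "P k"
      using inf unfolding infinite_nat_iff_unbounded by blast
    then obtain n where n: "k = Suc n"
      by (cases k) auto
    have "b m \<le> b n"
      using k n by (intro b(1)) simp
    also have "\<dots> \<le> a k"
      using upd k n by simp
    also have "\<dots> \<le> a'"
      using a by (rule incseq_le)
    finally show ?thesis .
  qed
  then show "\<exists>M. \<forall>m\<ge>M. b m \<le> a'"
    by blast
qed

text \<open>Continuity preserves the inequalities defining \<open>Low\<close> in the limit. Fairness
  supplies the reverse inequalities, and \<open>Low_le_postfixed\<close> then makes the limit the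
  greatest element.\<close>

lemma async_tfa_limit:
  assumes N: "valid_network N" and D: "delay_jitter_maps N D" and run: "async_tfa N D J z d"
    and fair: "\<And>i. i \<in> nodes N \<Longrightarrow> infinite {k. k \<ge> 1 \<and> i \<in> J k}"
    and lim: "z \<longlonglongrightarrow> z'" "d \<longlonglongrightarrow> d'"
  shows "(z', d') \<in> Low N D" and "\<And>x. x \<in> Low N D \<Longrightarrow> x \<le> (z', d')"
proof -
  note step = async_tfa_step[OF N D run]
  have z: "z k \<in> nonneg_vectors (z_index N)" and d: "d k \<in> nonneg_vectors (d_index N)"
    and zd: "z k \<le> burst_map N (d k)" "d k \<le> delay_map N D (z k)" for k
    using step(1)[of k] by (auto simp: Low_iff)
  have inc: "incseq z" "incseq d"
    using async_tfa_incseq[OF N D run] by auto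
  have limz: "(\<lambda>k. z k p) \<longlonglongrightarrow> z' p" and limd: "(\<lambda>k. d k q) \<longlonglongrightarrow> d' q" for p q
    using lim unfolding tendsto_fun_iff by blast+
  have z': "z' \<in> nonneg_vectors (z_index N)" and d': "d' \<in> nonneg_vectors (d_index N)"
    using nonneg_vectors_limit[OF z lim(1)] nonneg_vectors_limit[OF d lim(2)] by auto
  have limB: "(\<lambda>k. burst_map N (d k) p) \<longlonglongrightarrow> burst_map N d' p" if "p \<in> z_index N" for p
    using N that limd by (rule burst_map_tendsto)
  have limD: "(\<lambda>k. delay_map N D (z k) q) \<longlonglongrightarrow> delay_map N D z' q" if "q \<in> d_index N" for q
    using D that z z' limz by (rule delay_map_tendsto)
  have "z' p \<le> burst_map N d' p" if "p \<in> z_index N" for p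
    using le_funD[OF zd(1)] by (intro LIMSEQ_le[OF limz limB[OF that]]) blast
  then have "z' \<le> burst_map N d'"
    using z' by (auto simp: nonneg_vectors_iff extensional_le_iff[where A = "z_index N"])
  moreover have "d' q \<le> delay_map N D z' q" if "q \<in> d_index N" for q
    using le_funD[OF zd(2)] by (intro LIMSEQ_le[OF limd limD[OF that]]) blast
  then have "d' \<le> delay_map N D z'"
    using d' by (auto simp: nonneg_vectors_iff extensional_le_iff[where A = "d_index N"])
  ultimately show "(z', d') \<in> Low N D"
    using z' d' by (simp add: Low_iff)
  \<comment> \<open>Entry \<open>(l, f)\<close> is rewritten whenever its tail \<open>fst l\<close>
    is processed, so fairness is applied to that node.\<close>
  have "burst_map N d' (l, f) \<le> z' (l, f)" if lf: "(l, f) \<in> z_index N" for l f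
  proof (rule limit_ge_of_frequently[OF _ limz _ limB[OF lf] fair])
    show "incseq (\<lambda>k. z k (l, f))"
      using inc(1) unfolding incseq_def le_fun_def by blast
    show "burst_map N (d m) (l, f) \<le> burst_map N (d n) (l, f)" if "m \<le> n" for m n
      using burst_map_mono[OF N incseqD[OF inc(2) that]] by (rule le_funD)
    show "fst l \<in> nodes N"
      by (rule z_index_out_edges[OF N lf])
  qed (rule step(3)[OF lf])
  then have postB: "burst_map N d' \<le> z'"
    using z' by (auto simp: nonneg_vectors_iff extensional_le_iff[where A = "z_index N"])
  \<comment> \<open>For a delay entry the node to which fairness applies is \<open>i\<close>
    itself.\<close>
  have "delay_map N D z' (i, f) \<le> d' (i, f)" if "(i, f) \<in> d_index N" for i f
  proof (rule limit_ge_of_frequently[OF _ limd _ limD[OF that] fair])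
    show "incseq (\<lambda>k. d k (i, f))"
      using inc(2) unfolding incseq_def le_fun_def by blast
    show "delay_map N D (z m) (i, f) \<le> delay_map N D (z n) (i, f)" if "m \<le> n" for m n
      using delay_map_mono[OF D z z incseqD[OF inc(1) that]] by (rule le_funD)
    show "i \<in> nodes N"
      using that by (simp add: d_index_def)
  qed (rule step(4)[OF that])
  then have postD: "delay_map N D z' \<le> d'"
    using d' by (auto simp: nonneg_vectors_iff extensional_le_iff[where A = "d_index N"])
  show "x \<le> (z', d')" if "x \<in> Low N D" for x
    using Low_le_postfixed[OF N D _ z' d' postB postD] that by (cases x) blast
qed

section \<open>Boundedness and convergence\<close>

text \<open>Monotone convergence handles the coordinates in \<open>A\<close>; off \<open>A\<close>
  the sequence is constant. The coordinate limits assemble into a limit in the product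
  topology.\<close>

lemma bounded_incseq_extensional_tendsto:
  fixes X :: "nat \<Rightarrow> 'a \<Rightarrow> real"
  assumes inc: "incseq X" and ext: "\<And>k. X k \<in> extensional A"
    and B: "\<And>k p. p \<in> A \<Longrightarrow> X k p \<le> B"
  obtains L where "X \<longlonglongrightarrow> L"
proof -
  have "\<exists>l. (\<lambda>k. X k p) \<longlonglongrightarrow> l" for p
  proof (cases "p \<in> A")
    case True
    have "incseq (\<lambda>k. X k p)"
      using inc by (auto simp: incseq_def le_fun_def)
    from incseq_convergent[OF this] show ?thesis
      using B[OF True] by blast
  next
    case False
    then show ?thesis
      using ext by (auto simp: extensional_def)
  qed
  then obtain L where "\<And>p. (\<lambda>k. X k p) \<longlonglongrightarrow> L p"
    by metis
  then show thesis
    using that tendsto_fun_iff by blast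
qed

text \<open>Elements of \<open>Low\<close> are nonnegative, so an upper bound with finitely many
  coordinates bounds their absolute values uniformly. This serves the divergence claim by
  contraposition.\<close>

lemma bounded_vectors_Low_if_greatest:
  assumes N: "valid_network N" and ge: "\<And>x. x \<in> Low N D \<Longrightarrow> x \<le> (z', d')"
  shows "bounded_vectors N (Low N D)"
  unfolding bounded_vectors_def
proof (intro exI ballI)
  let ?S = "insert 0 (z' ` z_index N \<union> d' ` d_index N)"
  have fin: "finite ?S"
    using finite_z_index[OF N] finite_d_index[OF N] by simp
  fix x assume x: "x \<in> Low N D"
  obtain y e where ye: "x = (y, e)" by (cases x)
  have nonneg: "y \<in> nonneg_vectors (z_index N)" "e \<in> nonneg_vectors (d_index N)"
    using x by (auto simp: ye Low_iff)
  have le: "y \<le> z'" "e \<le> d'"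
    using ge[OF x] by (simp_all add: ye)
  have "\<bar>y p\<bar> \<le> Max ?S" if p: "p \<in> z_index N" for p
  proof -
    have "y p \<le> z' p"
      using le(1) by (rule le_funD)
    also have "\<dots> \<le> Max ?S"
      using p fin by (intro Max_ge) auto
    finally show ?thesis
      using nonneg(1) p by (simp add: nonneg_vectors_iff)
  qed
  moreover have "\<bar>e q\<bar> \<le> Max ?S" if q: "q \<in> d_index N" for q
  proof -
    have "e q \<le> d' q"
      using le(2) by (rule le_funD)
    also have "\<dots> \<le> Max ?S"
      using q fin by (intro Max_ge) auto
    finally show ?thesis
      using nonneg(2) q by (simp add: nonneg_vectors_iff)
  qed
  ultimately show "case x of (y, e) \<Rightarrow>
      (\<forall>p\<in>z_index N. \<bar>y p\<bar> \<le> Max ?S) \<and> (\<forall>q\<in>d_index N. \<bar>e q\<bar> \<le> Max ?S)"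
    by (simp add: ye)
qed

theorem theorem4:
  fixes N :: "('n, 'f) network"
    and D :: "'n \<Rightarrow> (('n \<times> 'n) \<times> 'f \<Rightarrow> real) \<Rightarrow> 'f \<Rightarrow> real"
    and J :: "nat \<Rightarrow> 'n set"
    and z :: "nat \<Rightarrow> ('n \<times> 'n) \<times> 'f \<Rightarrow> real"
    and d :: "nat \<Rightarrow> 'n \<times> 'f \<Rightarrow> real"
  assumes "valid_network N"
    and "delay_jitter_maps N D"
    and "\<And>k. k \<ge> 1 \<Longrightarrow> J k \<subseteq> nodes N"
    and "\<And>i. i \<in> nodes N \<Longrightarrow> infinite {k. k \<ge> 1 \<and> i \<in> J k}"
    and "async_tfa N D J z d"
  shows "incseq (\<lambda>k. (z k, d k)) \<and>
    (bounded_vectors N (Low N D) \<longrightarrow>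
       (\<exists>zbar dbar. (zbar, dbar) \<in> Low N D \<and> (\<forall>x \<in> Low N D. x \<le> (zbar, dbar)) \<and>
          (\<lambda>k. (z k, d k)) \<longlonglongrightarrow> (zbar, dbar))) \<and>
    (\<not> bounded_vectors N (Low N D) \<longrightarrow> \<not> convergent (\<lambda>k. (z k, d k)))"
proof (intro conjI impI)
  note inc = async_tfa_incseq[OF assms(1,2,5)]
  note limit = async_tfa_limit[OF assms(1,2,5,4)]
  show "incseq (\<lambda>k. (z k, d k))"
    by (rule inc(1))
  show "\<exists>zbar dbar. (zbar, dbar) \<in> Low N D \<and> (\<forall>x \<in> Low N D. x \<le> (zbar, dbar)) \<and>
      (\<lambda>k. (z k, d k)) \<longlonglongrightarrow> (zbar, dbar)" if bdd: "bounded_vectors N (Low N D)"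
  proof -
    \<comment> \<open>The iterates lie in \<open>Low\<close>, so a bound on \<open>Low\<close>
      bounds the run, and each component converges by monotonicity.\<close>
    have low: "(z k, d k) \<in> Low N D" for k
      by (rule async_tfa_step(1)[OF assms(1,2,5)])
    obtain B where B: "\<And>k p. p \<in> z_index N \<Longrightarrow> \<bar>z k p\<bar> \<le> B" "\<And>k q. q \<in> d_index N \<Longrightarrow> \<bar>d k q\<bar> \<le> B"
      using bdd low unfolding bounded_vectors_def by fast
    have ext: "z k \<in> extensional (z_index N)" "d k \<in> extensional (d_index N)" for k
      using low[of k] by (auto simp: Low_iff nonneg_vectors_iff)
    obtain zbar where zbar: "z \<longlonglongrightarrow> zbar"
      using bounded_incseq_extensional_tendsto[OF inc(2) ext(1) abs_le_D1[OF B(1)]] by blast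
    obtain dbar where dbar: "d \<longlonglongrightarrow> dbar"
      using bounded_incseq_extensional_tendsto[OF inc(3) ext(2) abs_le_D1[OF B(2)]] by blast
    show ?thesis
      using limit[OF _ zbar dbar] tendsto_Pair[OF zbar dbar] by blast
  qed
  show "\<not> convergent (\<lambda>k. (z k, d k))" if "\<not> bounded_vectors N (Low N D)"
  proof
    \<comment> \<open>A limit would be an upper bound of \<open>Low\<close>, contradicting
      unboundedness.\<close>
    assume "convergent (\<lambda>k. (z k, d k))"
    then obtain zbar dbar where "(\<lambda>k. (z k, d k)) \<longlonglongrightarrow> (zbar, dbar)"
      unfolding convergent_def by auto
    from tendsto_fst[OF this] tendsto_snd[OF this] have "z \<longlonglongrightarrow> zbar" "d \<longlonglongrightarrow> dbar"
      by simp_all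
    from limit(2)[OF _ this] have "bounded_vectors N (Low N D)"
      by (intro bounded_vectors_Low_if_greatest[OF assms(1)]) blast
    with that show False ..
  qed
qed

end
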